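(* Let $t, t'$ be arbitrary bisimilar BESsy structure graphs. Then for all environments $\eta$, $[\![\varphi(t)]\!]([\![\mathrm{BES}(t)]\!]\eta) = [\![\varphi(t')]\!]([\![\mathrm{BES}(t')]\!]\eta)$.
   Context: A structure graph $\langle T,t,\to,d,r,\nearrow\rangle$ has vertices, root $t$, edges $\to$, partial decoration $d:T\to\{\blacktriangle,\blacktriangledown,\top,\bot\}$ (conjunction, disjunction, true, false), partial rank $r:T\to\mathbb{N}$ and partial free-variable label $\nearrow$. It is BESsy if: vertices decorated $\top,\bot$ or with a free variable have no successors; a vertex is decorated $\blacktriangle$/$\blacktriangledown$ or ranked iff it has a successor; vertices with multiple successors are decorated $\blacktriangle$ or $\blacktriangledown$; every cycle contains a ranked vertex. Bisimilarity: related vertices have equal decoration, rank and free-variable label, and successors match up to the relation. Fix a total order on variables/constants lifted to formulae; $\mathrm{Conj}(\emptyset)=\mathsf{true}$, $\mathrm{Conj}(\{f\})=f\wedge f$, $\mathrm{Conj}(\{f\}\cup F)=f\wedge\mathrm{Conj}(F)$ for $f$ smaller than all of $F$; $\mathrm{Disj}$ dually with $\mathsf{false},\vee$. $\varphi(u)$ is $\mathrm{Conj}\{\varphi(u')\mid u\to u'\}$ (resp. $\mathrm{Disj}$) if $d(u)=\blacktriangle$ (resp. $\blacktriangledown$) and $u$ unranked, $\mathsf{true}$/$\mathsf{false}$ if $d(u)=\top/\bot$, $X$ if $\nearrow(u)=X$, and a fresh variable $X_u$ otherwise. $\mathrm{BES}(t)$ contains, for each ranked vertex $u$, an equation $\sigma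 X_u = \mathrm{rhs}(u)$ ($\sigma=\mu$ iff rank odd), ordered by descending rank, where $\mathrm{rhs}(u)$ is $\mathrm{Conj}\{\varphi(u')\mid u\to u'\}$ if $d(u)=\blacktriangle$, $\mathrm{Disj}\{\varphi(u')\mid u\to u'\}$ if $d(u)=\blacktriangledown$, else $\varphi(u')$ for the unique successor. $[\![\cdot]\!]\eta$ denotes BES solution / formula evaluation under environment $\eta$.
   Formalization: Graphs are taken finite, and every vertex reachable from t is assumed to have a decoration, rank or free-variable label: for two graphs that are single bare leaves, φ gives fresh variables X_u, X_{u'} without equations, and η may separate them, so the literal claim fails. *)

theory Defs
  imports Main
begin

section \<open>Boolean equation systems\<close>

datatype 'x form = TT | FF | Var 'x | And "'x form" "'x form" | Or "'x form" "'x form"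

type_synonym 'x env = "'x \<Rightarrow> bool"

primrec eval :: "'x form \<Rightarrow> 'x env \<Rightarrow> bool" where
  "eval TT \<eta> = True"
| "eval FF \<eta> = False"
| "eval (Var x) \<eta> = \<eta> x"
| "eval (And f g) \<eta> = (eval f \<eta> \<and> eval g \<eta>)"
| "eval (Or f g) \<eta> = (eval f \<eta> \<or> eval g \<eta>)"

datatype fixpoint_sign = Mu | Nu

type_synonym 'x bes = "(fixpoint_sign \<times> 'x \<times> 'x form) list"

text \<open>The first equation of the list is the outermost one: its variable is solved by substituting
  the extremal truth value (false for \<open>Mu\<close>, true for \<open>Nu\<close>) and solving the remaining equations.\<close>

fun sol :: "'x bes \<Rightarrow> 'x env \<Rightarrow> 'x env" where
  "sol [] \<eta> = \<eta>"
| "sol ((\<sigma>, x, f) # E) \<eta> = sol E (\<eta>(x := eval f (sol E (\<eta>(x := (\<sigma> = Nu))))))"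

section \<open>Conjunctions and disjunctions of finite sets of formulae\<close>

definition ordered_list :: "'a rel \<Rightarrow> 'a set \<Rightarrow> 'a list" where
  "ordered_list r F = (THE fs. set fs = F \<and> distinct fs \<and> sorted_wrt (\<lambda>f g. (f, g) \<in> r) fs)"

fun conj_list :: "'x form list \<Rightarrow> 'x form" where
  "conj_list [] = TT"
| "conj_list [f] = And f f"
| "conj_list (f # g # fs) = And f (conj_list (g # fs))"

fun disj_list :: "'x form list \<Rightarrow> 'x form" where
  "disj_list [] = FF"
| "disj_list [f] = Or f f"
| "disj_list (f # g # fs) = Or f (disj_list (g # fs))"

text \<open>Here \<open>r\<close> is a total order on formulae, smaller formulae coming first. The recursive
  equations for \<open>Conj\<close> and \<open>Disj\<close> on sets are derived below.\<close>

definition Conj :: "'x form rel \<Rightarrow> 'x form set \<Rightarrow> 'x form" where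
  "Conj r F = conj_list (ordered_list r F)"

definition Disj :: "'x form rel \<Rightarrow> 'x form set \<Rightarrow> 'x form" where
  "Disj r F = disj_list (ordered_list r F)"

lemma ordered_list_eqI:
  assumes "linear_order r" "set fs = F" "distinct fs" "sorted_wrt (\<lambda>f g. (f, g) \<in> r) fs"
  shows "ordered_list r F = fs"
proof -
  have anti: "antisym r"
    using assms(1) by (simp add: order_on_defs)
  have uniq: "gs = fs" if "set gs = set fs" "distinct gs" "sorted_wrt (\<lambda>f g. (f, g) \<in> r) gs" for gs
    using that assms(3,4)
  proof (induction gs arbitrary: fs)
    case Nil
    then show ?case by simp
  next
    case (Cons g gs)
    then obtain f fs' where fs: "fs = f # fs'"
      by (cases fs) auto
    have "g = f"
    proof (rule ccontr)
      assume "g \<noteq> f"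
      with Cons.prems fs have "g \<in> set fs'" "f \<in> set gs"
        by auto
      with Cons.prems fs have "(f, g) \<in> r" "(g, f) \<in> r"
        by auto
      with anti \<open>g \<noteq> f\<close> show False
        by (auto dest: antisymD)
    qed
    with Cons.prems fs have "set gs = set fs'"
      by (auto simp: insert_ident)
    with Cons fs \<open>g = f\<close> show ?case
      by auto
  qed
  show ?thesis
    unfolding ordered_list_def
    by (rule the_equality; (elim conjE)?; (rule uniq)?) (simp_all add: assms)
qed

lemma ordered_list_exists:
  assumes "linear_order r" "finite F"
  shows "\<exists>fs. set fs = F \<and> distinct fs \<and> sorted_wrt (\<lambda>f g. (f, g) \<in> r) fs"
  using assms(2)
proof (induction "card F" arbitrary: F)
  case 0
  then show ?case by auto
next
  case (Suc n)
  have ex_least: "\<exists>f\<in>A. \<forall>g\<in>A. (f, g) \<in> r" if "finite A" "A \<noteq> {}" for A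
    using that
  proof (induction rule: finite_ne_induct)
    case (singleton a)
    then show ?case
      using assms(1) by (auto simp: order_on_defs refl_on_def)
  next
    case (insert a A)
    then obtain f where f: "f \<in> A" "\<forall>g\<in>A. (f, g) \<in> r" by blast
    have tr: "trans r" and rf: "(a, a) \<in> r"
      using assms(1) by (auto simp: order_on_defs refl_on_def)
    have tot: "(a, f) \<in> r \<or> (f, a) \<in> r"
      using assms(1) rf by (cases "a = f") (auto simp: order_on_defs total_on_def)
    then show ?case
    proof
      assume "(a, f) \<in> r"
      with f(2) rf have "\<forall>g\<in>insert a A. (a, g) \<in> r"
        by (metis insertE tr transD)
      then show ?thesis by blast
    next
      assume "(f, a) \<in> r"
      with f show ?thesis by blast
    qed
  qed
  from Suc have "F \<noteq> {}" by auto
  with ex_least[OF Suc.prems] obtain f where f: "f \<in> F" "\<forall>g\<in>F. (f, g) \<in> r" by blast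
  have "n = card (F - {f})" using Suc f by simp
  from Suc.hyps(1)[OF this] Suc.prems obtain fs
    where fs: "set fs = F - {f}" "distinct fs" "sorted_wrt (\<lambda>f g. (f, g) \<in> r) fs"
    by auto
  with f show ?case by (intro exI[of _ "f # fs"]) auto
qed

lemma ordered_list_insert:
  assumes "linear_order r" "finite F" "f \<notin> F" "\<And>g. g \<in> F \<Longrightarrow> (f, g) \<in> r"
  shows "ordered_list r (insert f F) = f # ordered_list r F"
proof -
  obtain fs where fs: "set fs = F" "distinct fs" "sorted_wrt (\<lambda>f g. (f, g) \<in> r) fs"
    using ordered_list_exists[OF assms(1,2)] by blast
  have "ordered_list r F = fs"
    by (rule ordered_list_eqI[OF assms(1) fs])
  moreover have "ordered_list r (insert f F) = f # fs"
    using fs assms by (intro ordered_list_eqI) auto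
  ultimately show ?thesis by simp
qed

lemma ordered_list_empty: "linear_order r \<Longrightarrow> ordered_list r {} = []"
  by (rule ordered_list_eqI) auto

lemma ordered_list_eq_Nil:
  assumes "linear_order r" "finite F" "ordered_list r F = []"
  shows "F = {}"
proof -
  obtain fs where fs: "set fs = F" "distinct fs" "sorted_wrt (\<lambda>f g. (f, g) \<in> r) fs"
    using ordered_list_exists[OF assms(1,2)] by blast
  with ordered_list_eqI[OF assms(1) fs] assms(3) show ?thesis
    by simp
qed

lemma Conj_equations:
  assumes "linear_order r"
  shows "Conj r {} = TT"
    and "Conj r {f} = And f f"
    and "\<lbrakk>finite F; F \<noteq> {}; \<And>g. g \<in> F \<Longrightarrow> f \<noteq> g \<and> (f, g) \<in> r\<rbrakk>
      \<Longrightarrow> Conj r (insert f F) = And f (Conj r F)"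
proof -
  show "Conj r {} = TT"
    by (simp add: Conj_def ordered_list_empty[OF assms])
  show "Conj r {f} = And f f"
    by (simp add: Conj_def ordered_list_eqI[OF assms, of "[f]"])
next
  assume F: "finite F" "F \<noteq> {}" "\<And>g. g \<in> F \<Longrightarrow> f \<noteq> g \<and> (f, g) \<in> r"
  then obtain g gs where gs: "ordered_list r F = g # gs"
    using ordered_list_eq_Nil[OF assms F(1)] by (cases "ordered_list r F") auto
  have "ordered_list r (insert f F) = f # ordered_list r F"
    by (rule ordered_list_insert[OF assms F(1)]) (use F(3) in blast)+
  then show "Conj r (insert f F) = And f (Conj r F)"
    by (simp add: Conj_def gs)
qed

lemma Disj_equations:
  assumes "linear_order r"
  shows "Disj r {} = FF"
    and "Disj r {f} = Or f f"
    and "\<lbrakk>finite F; F \<noteq> {}; \<And>g. g \<in> F \<Longrightarrow> f \<noteq> g \<and> (f, g) \<in> r\<rbrakk>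
      \<Longrightarrow> Disj r (insert f F) = Or f (Disj r F)"
proof -
  show "Disj r {} = FF"
    by (simp add: Disj_def ordered_list_empty[OF assms])
  show "Disj r {f} = Or f f"
    by (simp add: Disj_def ordered_list_eqI[OF assms, of "[f]"])
next
  assume F: "finite F" "F \<noteq> {}" "\<And>g. g \<in> F \<Longrightarrow> f \<noteq> g \<and> (f, g) \<in> r"
  then obtain g gs where gs: "ordered_list r F = g # gs"
    using ordered_list_eq_Nil[OF assms F(1)] by (cases "ordered_list r F") auto
  have "ordered_list r (insert f F) = f # ordered_list r F"
    by (rule ordered_list_insert[OF assms F(1)]) (use F(3) in blast)+
  then show "Disj r (insert f F) = Or f (Disj r F)"
    by (simp add: Disj_def gs)
qed

section \<open>Structure graphs\<close>

datatype decoration = DAnd | DOr | DTop | DBot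

record ('v, 'x) sgraph =
  verts :: "'v set"
  root :: 'v
  edges :: "'v rel"
  dec :: "'v \<rightharpoonup> decoration"
  rank :: "'v \<rightharpoonup> nat"
  fvar :: "'v \<rightharpoonup> 'x"

definition structure_graph :: "('v, 'x) sgraph \<Rightarrow> bool" where
  "structure_graph G \<longleftrightarrow>
     finite (verts G) \<and> root G \<in> verts G \<and> edges G \<subseteq> verts G \<times> verts G"

abbreviation succs :: "('v, 'x) sgraph \<Rightarrow> 'v \<Rightarrow> 'v set" where
  "succs G u \<equiv> {u'. (u, u') \<in> edges G}"

definition cycle :: "('v, 'x) sgraph \<Rightarrow> 'v list \<Rightarrow> bool" where
  "cycle G us \<longleftrightarrow> us \<noteq> [] \<and> successively (\<lambda>u v. (u, v) \<in> edges G) (us @ [hd us])"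

definition BESsy :: "('v, 'x) sgraph \<Rightarrow> bool" where
  "BESsy G \<longleftrightarrow>
     (\<forall>u\<in>verts G. dec G u = Some DTop \<or> dec G u = Some DBot \<or> fvar G u \<noteq> None
        \<longrightarrow> succs G u = {}) \<and>
     (\<forall>u\<in>verts G. dec G u = Some DAnd \<or> dec G u = Some DOr \<or> rank G u \<noteq> None
        \<longleftrightarrow> succs G u \<noteq> {}) \<and>
     (\<forall>u\<in>verts G. (\<exists>v w. v \<noteq> w \<and> v \<in> succs G u \<and> w \<in> succs G u)
        \<longrightarrow> dec G u = Some DAnd \<or> dec G u = Some DOr) \<and>
     (\<forall>us. cycle G us \<longrightarrow> (\<exists>u\<in>set us. rank G u \<noteq> None))"

definition bisimulation ::
  "('v, 'x) sgraph \<Rightarrow> ('w, 'x) sgraph \<Rightarrow> ('v \<times> 'w) set \<Rightarrow> bool" where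
  "bisimulation G G' R \<longleftrightarrow> R \<subseteq> verts G \<times> verts G' \<and>
     (\<forall>(u, u')\<in>R.
        dec G u = dec G' u' \<and> rank G u = rank G' u' \<and> fvar G u = fvar G' u' \<and>
        (\<forall>v\<in>succs G u. \<exists>v'\<in>succs G' u'. (v, v') \<in> R) \<and>
        (\<forall>v'\<in>succs G' u'. \<exists>v\<in>succs G u. (v, v') \<in> R))"

definition bisimilar :: "('v, 'x) sgraph \<Rightarrow> ('w, 'x) sgraph \<Rightarrow> bool" where
  "bisimilar G G' \<longleftrightarrow> (\<exists>R. bisimulation G G' R \<and> (root G, root G') \<in> R)"

section \<open>From structure graphs to Boolean equation systems\<close>

text \<open>\<open>X u\<close> is the fresh variable associated with the vertex \<open>u\<close>.\<close>

definition fresh_vars :: "('v, 'x) sgraph \<Rightarrow> ('v \<Rightarrow> 'x) \<Rightarrow> bool" where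
  "fresh_vars G X \<longleftrightarrow>
     inj_on X (verts G) \<and> (\<forall>u\<in>verts G. \<forall>v\<in>verts G. fvar G v \<noteq> Some (X u))"

text \<open>The recursion only unfolds unranked vertices. It terminates on BESsy structure graphs
  (\<open>phi_dom_BESsy\<close> below), since there every cycle contains a ranked vertex; on other graphs
  the value may be unspecified.\<close>

function (domintros) phi ::
  "'x form rel \<Rightarrow> ('v \<Rightarrow> 'x) \<Rightarrow> ('v, 'x) sgraph \<Rightarrow> 'v \<Rightarrow> 'x form" where
  "phi r X G u =
     (if dec G u = Some DAnd \<and> rank G u = None then Conj r (phi r X G ` succs G u)
      else if dec G u = Some DOr \<and> rank G u = None then Disj r (phi r X G ` succs G u)
      else if dec G u = Some DTop then TT
      else if dec G u = Some DBot then FF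
      else (case fvar G u of Some Y \<Rightarrow> Var Y | None \<Rightarrow> Var (X u)))"
  by pat_completeness auto

definition rhs ::
  "'x form rel \<Rightarrow> ('v \<Rightarrow> 'x) \<Rightarrow> ('v, 'x) sgraph \<Rightarrow> 'v \<Rightarrow> 'x form" where
  "rhs r X G u =
     (if dec G u = Some DAnd then Conj r (phi r X G ` succs G u)
      else if dec G u = Some DOr then Disj r (phi r X G ` succs G u)
      else phi r X G (THE u'. u' \<in> succs G u))"

definition equation ::
  "'x form rel \<Rightarrow> ('v \<Rightarrow> 'x) \<Rightarrow> ('v, 'x) sgraph \<Rightarrow> 'v \<Rightarrow> fixpoint_sign \<times> 'x \<times> 'x form" where
  "equation r X G u = (if odd (the (rank G u)) then Mu else Nu, X u, rhs r X G u)"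

text \<open>The relative order of the equations of vertices with equal rank is left open.\<close>

definition is_BES ::
  "'x form rel \<Rightarrow> ('v \<Rightarrow> 'x) \<Rightarrow> ('v, 'x) sgraph \<Rightarrow> 'x bes \<Rightarrow> bool" where
  "is_BES r X G E \<longleftrightarrow>
     (\<exists>us. distinct us \<and> set us = {u \<in> verts G. rank G u \<noteq> None} \<and>
        sorted_wrt (\<lambda>u v. the (rank G u) \<ge> the (rank G v)) us \<and>
        E = map (equation r X G) us)"

lemma trancl_imp_walk:
  assumes "(u, v) \<in> S\<^sup>+"
  shows "\<exists>us. us \<noteq> [] \<and> hd us = u \<and> successively (\<lambda>x y. (x, y) \<in> S) (us @ [v])"
  using assms
proof (induction rule: trancl_induct)
  case (base v)
  then show ?case
    by (intro exI[of _ "[u]"]) auto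
next
  case (step v w)
  then obtain us where us: "us \<noteq> []" "hd us = u" "successively (\<lambda>x y. (x, y) \<in> S) (us @ [v])"
    by blast
  with step show ?case
    by (intro exI[of _ "us @ [v]"]) (auto simp: successively_append_iff)
qed

lemma phi_dom_BESsy:
  assumes "structure_graph G" "BESsy G"
  shows "phi_dom (r, X, G, u)"
proof -
  define S where "S = {(u, v). (u, v) \<in> edges G \<and> rank G u = None}"
  have "finite S"
    using assms(1) unfolding S_def structure_graph_def
    by (rule_tac finite_subset[of _ "verts G \<times> verts G"]) auto
  moreover have "acyclic S"
  proof (rule acyclicI, intro allI notI)
    fix x assume "(x, x) \<in> S\<^sup>+"
    then obtain us where us: "us \<noteq> []" "hd us = x"
      "successively (\<lambda>x y. (x, y) \<in> S) (us @ [x])"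
      using trancl_imp_walk by metis
    have bessy: "\<exists>y\<in>set us. rank G y \<noteq> None" if "cycle G us" for us
      using that assms(2) by (simp add: BESsy_def)
    have "cycle G us"
      unfolding cycle_def using us
      by (auto simp: S_def intro: successively_mono)
    moreover have "rank G y = None" if "y \<in> set us" for y
    proof -
      from that obtain as bs where "us = as @ y # bs"
        by (auto simp: in_set_conv_decomp)
      with us(3) have "\<exists>z. (y, z) \<in> S"
        by (cases bs) (auto simp: successively_append_iff)
      then show ?thesis
        by (auto simp: S_def)
    qed
    ultimately show False
      using bessy[of us] by fastforce
  qed
  ultimately have "wf (S\<inverse>)"
    by (rule finite_acyclic_wf_converse)
  then show ?thesis
  proof (induction u rule: wf_induct_rule)
    case (less u)
    show ?case
      by (rule phi.domintros; rule less) (auto simp: S_def)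
  qed
qed

end

theory Submission
  imports Defs
begin

text \<open>
  A block of consecutive equations with the same sign is solved by the simultaneous extremal
  (pre)fixpoint of its right-hand sides (Bekic). The solutions of the equations of rank
  below \<open>k\<close> are then compared by induction on \<open>k\<close>: the two graphs may have different numbers of
  vertices of a given rank, but the solution for one graph, pulled back along the
  bisimulation by taking meets, is a prefixpoint for the other. Only one-sided comparisons are
  preserved by this argument, so both directions are carried along in the induction.
\<close>

section \<open>Blocks of equations\<close>

text \<open>The order in which the solution of a block of sign \<open>\<sigma>\<close> is least.\<close>

definition sgn_le :: "fixpoint_sign \<Rightarrow> bool \<Rightarrow> bool \<Rightarrow> bool" where
  "sgn_le \<sigma> a b \<longleftrightarrow> (if \<sigma> = Mu then a \<longrightarrow> b else b \<longrightarrow> a)"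

definition bound_vars :: "'x bes \<Rightarrow> 'x set" where
  "bound_vars E = (\<lambda>(\<sigma>, x, f). x) ` set E"

lemma bound_vars_simps [simp]:
  "bound_vars [] = {}"
  "bound_vars ((\<sigma>, x, f) # E) = insert x (bound_vars E)"
  "bound_vars (E @ E') = bound_vars E \<union> bound_vars E'"
  by (auto simp: bound_vars_def image_Un)

section \<open>Monotonicity in both truth orders\<close>

lemma sgn_le_trans: "sgn_le \<sigma> a b \<Longrightarrow> sgn_le \<sigma> b c \<Longrightarrow> sgn_le \<sigma> a c"
  by (auto simp: sgn_le_def split: if_splits)

lemma sgn_le_flip: "\<sigma> \<noteq> \<tau> \<Longrightarrow> sgn_le \<tau> a b \<longleftrightarrow> sgn_le \<sigma> b a"
  by (cases \<sigma>; cases \<tau>) (auto simp: sgn_le_def)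

text \<open>Formulae contain no negation, so evaluation is monotone for both orders.\<close>

lemma eval_mono:
  assumes "\<And>x. sgn_le \<sigma> (\<rho> x) (\<rho>' x)"
  shows "sgn_le \<sigma> (eval f \<rho>) (eval f \<rho>')"
  using assms by (induction f) (auto simp: sgn_le_def split: if_splits)

text \<open>The value assigned to the head variable is itself monotone in the environment, so the
  updated environments stay comparable and the induction hypothesis applies a second time.\<close>

lemma sol_mono:
  assumes "\<And>x. sgn_le \<sigma> (\<rho> x) (\<rho>' x)"
  shows "sgn_le \<sigma> (sol E \<rho> x) (sol E \<rho>' x)"
  using assms
proof (induction E arbitrary: \<rho> \<rho>' x)
  case Nil
  then show ?case by simp
next
  case (Cons e E)
  obtain \<tau> y f where e: "e = (\<tau>, y, f)"
    by (cases e)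
  have "sgn_le \<sigma> (eval f (sol E (\<rho>(y := (\<tau> = Nu))))) (eval f (sol E (\<rho>'(y := (\<tau> = Nu)))))"
    by (intro eval_mono Cons.IH) (use Cons.prems in \<open>auto simp: sgn_le_def\<close>)
  then show ?case
    using Cons.prems unfolding e sol.simps by (intro Cons.IH) auto
qed

text \<open>\<open>E\<close> is the system that follows the block; it is solved in
  \<open>\<rho>\<close> before the right-hand sides of \<open>B\<close> are read. For
  \<open>Nu\<close> these are postfixpoints in the usual order.\<close>

definition prefixpoint :: "fixpoint_sign \<Rightarrow> 'x bes \<Rightarrow> 'x bes \<Rightarrow> 'x env \<Rightarrow> 'x env \<Rightarrow> bool" where
  "prefixpoint \<sigma> B E \<eta> \<rho> \<longleftrightarrow> (\<forall>x. x \<notin> bound_vars B \<longrightarrow> \<rho> x = \<eta> x) \<and>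
     (\<forall>x f. (\<sigma>, x, f) \<in> set B \<longrightarrow> sgn_le \<sigma> (eval f (sol E \<rho>)) (\<rho> x))"

text \<open>The witness is the environment handed on to \<open>E\<close>. Each induction step merges
  the head variable with the simultaneous solution of the tail block, which is taken with the head
  variable fixed.\<close>

lemma sol_block:
  assumes "\<And>e. e \<in> set B \<Longrightarrow> fst e = \<sigma>" "distinct (map (\<lambda>(\<sigma>, x, f). x) B)"
  shows "\<exists>\<rho>. sol (B @ E) \<eta> = sol E \<rho> \<and> (\<forall>x. x \<notin> bound_vars B \<longrightarrow> \<rho> x = \<eta> x) \<and>
    (\<forall>x f. (\<sigma>, x, f) \<in> set B \<longrightarrow> eval f (sol E \<rho>) = \<rho> x) \<and>
    (\<forall>\<rho>'. prefixpoint \<sigma> B E \<eta> \<rho>' \<longrightarrow> (\<forall>x. sgn_le \<sigma> (\<rho> x) (\<rho>' x)))"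
  using assms
proof (induction B arbitrary: \<eta>)
  case Nil
  then show ?case
    by (auto simp: sgn_le_def prefixpoint_def)
next
  case (Cons e B)
  obtain x f where e: "e = (\<sigma>, x, f)"
    using Cons.prems(1)[of e] by (cases e) auto
  have x: "x \<notin> bound_vars B"
    using Cons.prems(2) by (auto simp: e bound_vars_def)
  \<comment> \<open>\<open>g c\<close> is the head right-hand side once the rest is solved with
    \<open>x\<close> set to \<open>c\<close>; \<open>b\<close> is the value that \<open>sol\<close>
    assigns to \<open>x\<close>.\<close>
  define g where "g c = eval f (sol (B @ E) (\<eta>(x := c)))" for c
  define b where "b = g (\<sigma> = Nu)"
  have IH: "\<exists>\<rho>. sol (B @ E) \<eta> = sol E \<rho> \<and> (\<forall>x. x \<notin> bound_vars B \<longrightarrow> \<rho> x = \<eta> x) \<and>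
    (\<forall>x f. (\<sigma>, x, f) \<in> set B \<longrightarrow> eval f (sol E \<rho>) = \<rho> x) \<and>
    (\<forall>\<rho>'. prefixpoint \<sigma> B E \<eta> \<rho>' \<longrightarrow> (\<forall>x. sgn_le \<sigma> (\<rho> x) (\<rho>' x)))" for \<eta>
    using Cons.prems by (intro Cons.IH) auto
  from IH[of "\<eta>(x := b)"] obtain \<rho> where
    sol: "sol (B @ E) (\<eta>(x := b)) = sol E \<rho>" and
    out: "\<And>y. y \<notin> bound_vars B \<Longrightarrow> \<rho> y = (\<eta>(x := b)) y" and
    fp: "\<And>y f. (\<sigma>, y, f) \<in> set B \<Longrightarrow> eval f (sol E \<rho>) = \<rho> y" and
    least: "\<And>\<rho>' y. prefixpoint \<sigma> B E (\<eta>(x := b)) \<rho>' \<Longrightarrow> sgn_le \<sigma> (\<rho> y) (\<rho>' y)"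
    by blast
  \<comment> \<open>A monotone function on two truth values reaches its extremal fixpoint after one
    application to the extremal value.\<close>
  have "g False \<longrightarrow> g True"
    using eval_mono[of Mu "sol (B @ E) (\<eta>(x := False))" "sol (B @ E) (\<eta>(x := True))" f,
        OF sol_mono]
    by (auto simp: g_def sgn_le_def)
  then have "g b = b"
    by (cases \<sigma>; cases "g True"; cases "g False") (auto simp: b_def)
  then have x_fp: "eval f (sol E \<rho>) = \<rho> x"
    using out[OF x] by (simp add: g_def sol)
  have "sgn_le \<sigma> (\<rho> y) (\<rho>' y)"
    if prefixpoint: "prefixpoint \<sigma> (e # B) E \<eta> \<rho>'" for \<rho>' y
  proof -
    have out': "\<And>y. y \<notin> bound_vars (e # B) \<Longrightarrow> \<rho>' y = \<eta> y"
      and pre: "\<And>y f. (\<sigma>, y, f) \<in> set (e # B) \<Longrightarrow> sgn_le \<sigma> (eval f (sol E \<rho>')) (\<rho>' y)"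
      using prefixpoint unfolding prefixpoint_def by blast+
    \<comment> \<open>The least value for \<open>sgn_le \<sigma>\<close> is
      \<open>\<sigma> = Nu\<close>. If \<open>\<rho>' x\<close> is this value, then
      \<open>\<rho>'\<close> is a prefixpoint of the tail block with \<open>x\<close> at its
      starting value, so the environment \<open>\<rho>1\<close> that yields \<open>b\<close> lies
      below it. Otherwise \<open>\<rho>' x\<close> is the greatest value.\<close>
    have b_le: "sgn_le \<sigma> b (\<rho>' x)"
    proof (cases "\<rho>' x = (\<sigma> = Nu)")
      case True
      from IH[of "\<eta>(x := \<rho>' x)"] obtain \<rho>1 where
        sol1: "sol (B @ E) (\<eta>(x := \<rho>' x)) = sol E \<rho>1" and
        least1: "prefixpoint \<sigma> B E (\<eta>(x := \<rho>' x)) \<rho>' \<Longrightarrow> \<forall>y. sgn_le \<sigma> (\<rho>1 y) (\<rho>' y)"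
        by blast
      have "\<forall>y. sgn_le \<sigma> (\<rho>1 y) (\<rho>' y)"
        using least1 out' pre by (auto simp: e prefixpoint_def)
      then have "sgn_le \<sigma> (eval f (sol E \<rho>1)) (eval f (sol E \<rho>'))"
        by (intro eval_mono sol_mono) auto
      moreover have "sgn_le \<sigma> (eval f (sol E \<rho>')) (\<rho>' x)"
        using pre by (simp add: e)
      moreover have "b = eval f (sol E \<rho>1)"
        unfolding b_def g_def sol1[symmetric] True ..
      ultimately show ?thesis
        by (auto intro: sgn_le_trans)
    next
      case False
      then show ?thesis
        by (cases \<sigma>) (auto simp: sgn_le_def)
    qed
    have le: "sgn_le \<sigma> ((\<rho>'(x := b)) y) (\<rho>' y)" for y
      using b_le by (auto simp: sgn_le_def)
    \<comment> \<open>Lowering \<open>x\<close> to \<open>b\<close> lowers the right-hand sides of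
      \<open>B\<close> and keeps the values of its variables, so the changed environment is a
      prefixpoint of the tail block.\<close>
    have "sgn_le \<sigma> (\<rho> y) ((\<rho>'(x := b)) y)" for y
    proof (rule least, unfold prefixpoint_def, intro conjI allI impI)
      fix y assume "y \<notin> bound_vars B"
      then show "(\<rho>'(x := b)) y = (\<eta>(x := b)) y"
        using out' by (auto simp: e)
    next
      fix y h assume yh: "(\<sigma>, y, h) \<in> set B"
      then have "y \<noteq> x"
        using x by (force simp: bound_vars_def)
      moreover have "sgn_le \<sigma> (eval h (sol E (\<rho>'(x := b)))) (eval h (sol E \<rho>'))"
        by (intro eval_mono sol_mono le)
      then have "sgn_le \<sigma> (eval h (sol E (\<rho>'(x := b)))) (\<rho>' y)"
        by (rule sgn_le_trans) (use pre yh in simp)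
      ultimately show "sgn_le \<sigma> (eval h (sol E (\<rho>'(x := b)))) ((\<rho>'(x := b)) y)"
        by simp
    qed
    from this[of y] le[of y] show ?thesis
      by (rule sgn_le_trans)
  qed
  moreover have "sol ((e # B) @ E) \<eta> = sol E \<rho>"
    using sol by (simp add: e b_def g_def)
  moreover have "\<forall>y. y \<notin> bound_vars (e # B) \<longrightarrow> \<rho> y = \<eta> y"
    using out by (auto simp: e)
  moreover have "\<forall>y h. (\<sigma>, y, h) \<in> set (e # B) \<longrightarrow> eval h (sol E \<rho>) = \<rho> y"
    using fp x_fp by (auto simp: e)
  ultimately show ?case
    by blast
qed

text \<open>The left block contributes leastness and the right block only its fixpoint equations: a
  prefixpoint on the left that lies below the right solution along \<open>Q\<close> suffices.
  \<open>Q\<close> may be many-to-many, so the blocks can differ in length.\<close>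

lemma sol_block_le:
  fixes Q :: "'x rel"
  assumes signs: "\<And>e. e \<in> set B \<Longrightarrow> fst e = \<sigma>" "\<And>e. e \<in> set B' \<Longrightarrow> fst e = \<sigma>"
    and dist: "distinct (map (\<lambda>(\<sigma>, x, f). x) B)" "distinct (map (\<lambda>(\<sigma>, x, f). x) B')"
    and bound: "\<And>x x'. (x, x') \<in> Q \<Longrightarrow> x \<in> bound_vars B \<longleftrightarrow> x' \<in> bound_vars B'"
    and rhs: "\<And>x x' f f' \<rho> \<rho>'. \<lbrakk>(\<sigma>, x, f) \<in> set B; (\<sigma>, x', f') \<in> set B'; (x, x') \<in> Q;
        \<forall>(x, x')\<in>Q. sgn_le \<sigma> (\<rho> x) (\<rho>' x')\<rbrakk> \<Longrightarrow> sgn_le \<sigma> (eval f \<rho>) (eval f' \<rho>')"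
    and inner: "\<And>\<rho> \<rho>'. \<forall>(x, x')\<in>Q. x \<notin> bound_vars E \<longrightarrow> sgn_le \<sigma> (\<rho> x) (\<rho>' x') \<Longrightarrow>
        \<forall>(x, x')\<in>Q. sgn_le \<sigma> (sol E \<rho> x) (sol E' \<rho>' x')"
    and le: "\<forall>(x, x')\<in>Q. x \<notin> bound_vars (B @ E) \<longrightarrow> sgn_le \<sigma> (\<eta> x) (\<eta>' x')"
  shows "\<forall>(x, x')\<in>Q. sgn_le \<sigma> (sol (B @ E) \<eta> x) (sol (B' @ E') \<eta>' x')"
proof -
  obtain \<rho> where \<rho>: "sol (B @ E) \<eta> = sol E \<rho>" "\<And>x. x \<notin> bound_vars B \<Longrightarrow> \<rho> x = \<eta> x"
    and least: "\<And>\<rho>' x. prefixpoint \<sigma> B E \<eta> \<rho>' \<Longrightarrow> sgn_le \<sigma> (\<rho> x) (\<rho>' x)"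
    using sol_block[of B \<sigma> E \<eta>] signs(1) dist(1) by blast
  obtain \<rho>' where \<rho>': "sol (B' @ E') \<eta>' = sol E' \<rho>'" "\<And>x. x \<notin> bound_vars B' \<Longrightarrow> \<rho>' x = \<eta>' x"
    and fp': "\<And>x f. (\<sigma>, x, f) \<in> set B' \<Longrightarrow> eval f (sol E' \<rho>') = \<rho>' x"
    using sol_block[of B' \<sigma> E' \<eta>'] signs(2) dist(2) by blast
  \<comment> \<open>On block variables this is the meet, in the order
    \<open>sgn_le \<sigma>\<close>, of the right-hand values related to \<open>x\<close>; a block
    variable without partner gets the greatest value.\<close>
  define pull where "pull x = (if x \<in> bound_vars B
      then (if \<sigma> = Mu then \<forall>x'. (x, x') \<in> Q \<longrightarrow> \<rho>' x' else \<exists>x'. (x, x') \<in> Q \<and> \<rho>' x')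
      else \<eta> x)" for x
  have outside: "sgn_le \<sigma> (\<eta> x) (\<rho>' x')"
    if "(x, x') \<in> Q" "x \<notin> bound_vars B" "x \<notin> bound_vars E" for x x'
    using that le bound \<rho>'(2) by fastforce
  have pull_le: "sgn_le \<sigma> (pull x) (\<rho>' x')" if "(x, x') \<in> Q" "x \<notin> bound_vars E" for x x'
  proof (cases "x \<in> bound_vars B")
    case True
    then show ?thesis
      using that by (auto simp: pull_def sgn_le_def)
  next
    case False
    then show ?thesis
      using outside that by (simp add: pull_def)
  qed
  have inner_pull: "\<forall>(x, x')\<in>Q. sgn_le \<sigma> (sol E pull x) (sol E' \<rho>' x')"
    by (rule inner) (use pull_le in blast)
  have \<rho>_le: "sgn_le \<sigma> (\<rho> x) (pull x)" for x
  proof (rule least, unfold prefixpoint_def, intro conjI allI impI)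
    fix x assume "x \<notin> bound_vars B"
    then show "pull x = \<eta> x"
      by (simp add: pull_def)
  next
    fix x f assume f: "(\<sigma>, x, f) \<in> set B"
    then have x: "x \<in> bound_vars B"
      by (force simp: bound_vars_def)
    \<comment> \<open>The related right-hand side equals \<open>\<rho>' x'\<close> because
      \<open>\<rho>'\<close> solves its block. A bound by every such value is a bound by their
      meet.\<close>
    have "sgn_le \<sigma> (eval f (sol E pull)) (\<rho>' x')" if Q: "(x, x') \<in> Q" for x'
    proof -
      have "x' \<in> bound_vars B'"
        using bound[OF Q] x by simp
      then obtain f' where f': "(\<sigma>, x', f') \<in> set B'"
        using signs(2) by (force simp: bound_vars_def)
      show ?thesis
        using rhs[OF f f' Q inner_pull] fp'[OF f'] by simp
    qed
    then show "sgn_le \<sigma> (eval f (sol E pull)) (pull x)"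
      using x by (auto simp: pull_def sgn_le_def)
  qed
  show ?thesis
    unfolding \<rho>(1) \<rho>'(1)
  proof (rule inner, clarify)
    fix x x' assume "(x, x') \<in> Q" "x \<notin> bound_vars E"
    then show "sgn_le \<sigma> (\<rho> x) (\<rho>' x')"
      by (rule sgn_le_trans[OF \<rho>_le pull_le])
  qed
qed

section \<open>Formulae of bisimilar vertices\<close>

lemma eval_conj_list: "eval (conj_list fs) \<rho> \<longleftrightarrow> (\<forall>f\<in>set fs. eval f \<rho>)"
  by (induction fs rule: conj_list.induct) auto

lemma eval_disj_list: "eval (disj_list fs) \<rho> \<longleftrightarrow> (\<exists>f\<in>set fs. eval f \<rho>)"
  by (induction fs rule: disj_list.induct) auto

text \<open>Finiteness makes the definite description in \<open>ordered_list\<close> denote. From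
  here on the order \<open>r\<close> has no semantic effect.\<close>

lemma set_ordered_list: "linear_order r \<Longrightarrow> finite F \<Longrightarrow> set (ordered_list r F) = F"
  using ordered_list_exists ordered_list_eqI by metis

lemma eval_Conj: "linear_order r \<Longrightarrow> finite F \<Longrightarrow> eval (Conj r F) \<rho> \<longleftrightarrow> (\<forall>f\<in>F. eval f \<rho>)"
  by (simp add: Conj_def eval_conj_list set_ordered_list)

lemma eval_Disj: "linear_order r \<Longrightarrow> finite F \<Longrightarrow> eval (Disj r F) \<rho> \<longleftrightarrow> (\<exists>f\<in>F. eval f \<rho>)"
  by (simp add: Disj_def eval_disj_list set_ordered_list)

lemma finite_succs: "structure_graph G \<Longrightarrow> finite (succs G u)"
  unfolding structure_graph_def by (rule finite_subset[of _ "verts G"]) auto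

text \<open>The last two assumptions have the shape of the two matching conditions of a
  bisimulation; the sign \<open>\<tau>\<close> decides which of them carries the inequality.\<close>

lemma sgn_le_ConjI:
  assumes "linear_order r" "finite V" "finite V'"
    and "\<And>v. v \<in> V \<Longrightarrow> \<exists>v'\<in>V'. sgn_le \<tau> (eval (f v) \<rho>) (eval (f' v') \<rho>')"
    and "\<And>v'. v' \<in> V' \<Longrightarrow> \<exists>v\<in>V. sgn_le \<tau> (eval (f v) \<rho>) (eval (f' v') \<rho>')"
  shows "sgn_le \<tau> (eval (Conj r (f ` V)) \<rho>) (eval (Conj r (f' ` V')) \<rho>')"
  using assms(4,5)
  unfolding eval_Conj[OF assms(1) finite_imageI[OF assms(2)]]
    eval_Conj[OF assms(1) finite_imageI[OF assms(3)]] sgn_le_def ball_simps bex_simps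
  by (cases \<tau>) (simp_all, blast+)

lemma sgn_le_DisjI:
  assumes "linear_order r" "finite V" "finite V'"
    and "\<And>v. v \<in> V \<Longrightarrow> \<exists>v'\<in>V'. sgn_le \<tau> (eval (f v) \<rho>) (eval (f' v') \<rho>')"
    and "\<And>v'. v' \<in> V' \<Longrightarrow> \<exists>v\<in>V. sgn_le \<tau> (eval (f v) \<rho>) (eval (f' v') \<rho>')"
  shows "sgn_le \<tau> (eval (Disj r (f ` V)) \<rho>) (eval (Disj r (f' ` V')) \<rho>')"
  using assms(4,5)
  unfolding eval_Disj[OF assms(1) finite_imageI[OF assms(2)]]
    eval_Disj[OF assms(1) finite_imageI[OF assms(3)]] sgn_le_def ball_simps bex_simps
  by (cases \<tau>) (simp_all, blast+)

text \<open>Fresh variables are related only for ranked vertices, since these are bound by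
  equations; an unranked vertex would give variables whose values \<open>\<eta>\<close> chooses
  independently. Free-variable labels are shared by both graphs and hence related to
  themselves.\<close>

definition var_rel ::
  "('v, 'x) sgraph \<Rightarrow> ('v \<Rightarrow> 'x) \<Rightarrow> ('w \<Rightarrow> 'x) \<Rightarrow> ('v \<times> 'w) set \<Rightarrow> 'x rel" where
  "var_rel G X X' R = {(X u, X' u') | u u'. (u, u') \<in> R \<and> rank G u \<noteq> None} \<union>
     {(Y, Y) | Y. \<exists>(u, u')\<in>R. fvar G u = Some Y}"

lemma bisim_verts: "bisimulation G G' R \<Longrightarrow> (u, u') \<in> R \<Longrightarrow> u \<in> verts G \<and> u' \<in> verts G'"
  by (auto simp: bisimulation_def)

lemma bisim_labels:
  "bisimulation G G' R \<Longrightarrow> (u, u') \<in> R \<Longrightarrow>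
    dec G' u' = dec G u \<and> rank G' u' = rank G u \<and> fvar G' u' = fvar G u"
  by (auto simp: bisimulation_def)

lemma bisim_succ:
  "bisimulation G G' R \<Longrightarrow> (u, u') \<in> R \<Longrightarrow> v \<in> succs G u \<Longrightarrow> \<exists>v'\<in>succs G' u'. (v, v') \<in> R"
  unfolding bisimulation_def by blast

lemma bisim_succ':
  "bisimulation G G' R \<Longrightarrow> (u, u') \<in> R \<Longrightarrow> v' \<in> succs G' u' \<Longrightarrow> \<exists>v\<in>succs G u. (v, v') \<in> R"
  unfolding bisimulation_def by blast

section \<open>Comparison of formulae along a bisimulation\<close>

context
  fixes G :: "('v, 'x) sgraph" and G' :: "('w, 'x) sgraph"
    and r :: "'x form rel" and X :: "'v \<Rightarrow> 'x" and X' :: "'w \<Rightarrow> 'x" and R :: "('v \<times> 'w) set"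
  assumes r: "linear_order r"
    and G: "structure_graph G" "BESsy G"
    and G': "structure_graph G'" "BESsy G'"
    and R: "bisimulation G G' R"
    and labelled: "\<And>u. u \<in> Domain R \<Longrightarrow> dec G u \<noteq> None \<or> rank G u \<noteq> None \<or> fvar G u \<noteq> None"
begin

text \<open>Induction along the recursion of \<open>phi\<close> on \<open>G\<close>, with
  \<open>G'\<close> unfolded in parallel. Where the recursion stops, equal labels give the same
  constant or two variables related by \<open>var_rel\<close>.\<close>

lemma phi_le:
  assumes le: "\<forall>(x, x')\<in>var_rel G X X' R. sgn_le \<tau> (\<rho> x) (\<rho>' x')"
    and "(u, u') \<in> R"
  shows "sgn_le \<tau> (eval (phi r X G u) \<rho>) (eval (phi r X' G' u') \<rho>')"
proof -
  have "sgn_le \<tau> (eval (phi r X G u) \<rho>) (eval (phi r X' G' u') \<rho>')"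
    if "phi_dom (r0, X0, G0, u)" "r0 = r" "X0 = X" "G0 = G" "(u, u') \<in> R" for r0 X0 G0 u u'
    using that
  proof (induction r0 X0 G0 u arbitrary: u' rule: phi.pinduct)
    case (1 r0 X0 G0 u)
    note eqs = \<open>r0 = r\<close> \<open>X0 = X\<close> \<open>G0 = G\<close> and uu' = \<open>(u, u') \<in> R\<close>
    note unfold = phi.psimps[OF phi_dom_BESsy[OF G], of r X u]
      phi.psimps[OF phi_dom_BESsy[OF G'], of r X' u']
    note fin = finite_succs[OF G(1)] finite_succs[OF G'(1)]
    have labels: "dec G' u' = dec G u" "rank G' u' = rank G u" "fvar G' u' = fvar G u"
      using bisim_labels[OF R uu'] by auto
    consider (conj) "dec G u = Some DAnd" "rank G u = None"
      | (disj) "dec G u = Some DOr" "rank G u = None"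
      | (leaf) "\<not> (dec G u = Some DAnd \<and> rank G u = None)"
          "\<not> (dec G u = Some DOr \<and> rank G u = None)"
      by argo
    then show ?case
    proof cases
      case conj
      have IH: "sgn_le \<tau> (eval (phi r X G v) \<rho>) (eval (phi r X' G' v') \<rho>')"
        if "v \<in> succs G u" "(v, v') \<in> R" for v v'
        using "1.IH"(1) conj that eqs by blast
      have "sgn_le \<tau> (eval (Conj r (phi r X G ` succs G u)) \<rho>)
          (eval (Conj r (phi r X' G' ` succs G' u')) \<rho>')"
        by (rule sgn_le_ConjI[OF r fin])
          (use IH bisim_succ[OF R uu'] bisim_succ'[OF R uu'] in blast)+
      then show ?thesis
        by (simp add: unfold labels conj)
    next
      case disj
      have IH: "sgn_le \<tau> (eval (phi r X G v) \<rho>) (eval (phi r X' G' v') \<rho>')"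
        if "v \<in> succs G u" "(v, v') \<in> R" for v v'
        using "1.IH"(2) disj that eqs by auto
      have "sgn_le \<tau> (eval (Disj r (phi r X G ` succs G u)) \<rho>)
          (eval (Disj r (phi r X' G' ` succs G' u')) \<rho>')"
        by (rule sgn_le_DisjI[OF r fin])
          (use IH bisim_succ[OF R uu'] bisim_succ'[OF R uu'] in blast)+
      then show ?thesis
        by (simp add: unfold labels disj)
    next
      case leaf
      have "(X u, X' u') \<in> var_rel G X X' R" if "rank G u \<noteq> None"
        using uu' that unfolding var_rel_def by blast
      then have X: "sgn_le \<tau> (\<rho> (X u)) (\<rho>' (X' u'))" if "rank G u \<noteq> None"
        using le that by blast
      have "(Y, Y) \<in> var_rel G X X' R" if "fvar G u = Some Y" for Y
        using uu' that unfolding var_rel_def by blast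
      then have Y: "sgn_le \<tau> (\<rho> Y) (\<rho>' Y)" if "fvar G u = Some Y" for Y
        using le that by blast
      \<comment> \<open>This rules out an unbound fresh variable: an undecorated vertex is ranked by
        \<open>labelled\<close>, a conjunctive or disjunctive one because the unranked cases are
        already treated.\<close>
      have "rank G u \<noteq> None" if "dec G u \<noteq> Some DTop" "dec G u \<noteq> Some DBot" "fvar G u = None"
      proof (cases "dec G u")
        case None
        then show ?thesis
          using labelled[OF DomainI[OF uu']] that by simp
      next
        case (Some a)
        then show ?thesis
          using leaf that by (cases a) auto
      qed
      then have "sgn_le \<tau> (eval (case fvar G u of Some Y \<Rightarrow> Var Y | None \<Rightarrow> Var (X u)) \<rho>)
          (eval (case fvar G u of Some Y \<Rightarrow> Var Y | None \<Rightarrow> Var (X' u')) \<rho>')"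
        if "dec G u \<noteq> Some DTop" "dec G u \<noteq> Some DBot"
        using X Y that by (cases "fvar G u") auto
      moreover have "sgn_le \<tau> a a" for a
        by (simp add: sgn_le_def)
      ultimately show ?thesis
        unfolding unfold labels using leaf by auto
    qed
  qed
  then show ?thesis
    using phi_dom_BESsy[OF G] assms(2) by blast
qed

text \<open>The vertex itself is unfolded despite its rank; its successors are then compared by
  \<open>phi_le\<close>, so no further induction occurs.\<close>

lemma rhs_le:
  assumes le: "\<forall>(x, x')\<in>var_rel G X X' R. sgn_le \<tau> (\<rho> x) (\<rho>' x')"
    and uu': "(u, u') \<in> R" and rank: "rank G u \<noteq> None"
  shows "sgn_le \<tau> (eval (rhs r X G u) \<rho>) (eval (rhs r X' G' u') \<rho>')"
proof -
  note fin = finite_succs[OF G(1)] finite_succs[OF G'(1)]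
  have labels: "dec G' u' = dec G u" "rank G' u' = rank G u"
    using bisim_labels[OF R uu'] by auto
  consider "dec G u = Some DAnd" | "dec G u = Some DOr"
    | (other) "dec G u \<noteq> Some DAnd" "dec G u \<noteq> Some DOr"
    by blast
  then show ?thesis
  proof cases
    case 1
    have "sgn_le \<tau> (eval (Conj r (phi r X G ` succs G u)) \<rho>)
        (eval (Conj r (phi r X' G' ` succs G' u')) \<rho>')"
      by (rule sgn_le_ConjI[OF r fin])
        (use phi_le[OF le] bisim_succ[OF R uu'] bisim_succ'[OF R uu'] in blast)+
    then show ?thesis
      by (simp add: rhs_def labels 1)
  next
    case 2
    have "sgn_le \<tau> (eval (Disj r (phi r X G ` succs G u)) \<rho>)
        (eval (Disj r (phi r X' G' ` succs G' u')) \<rho>')"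
      by (rule sgn_le_DisjI[OF r fin])
        (use phi_le[OF le] bisim_succ[OF R uu'] bisim_succ'[OF R uu'] in blast)+
    then show ?thesis
      by (simp add: rhs_def labels 2)
  next
    case other
    have u: "u \<in> verts G" "u' \<in> verts G'"
      using bisim_verts[OF R uu'] by auto
    \<comment> \<open>In a BESsy graph a ranked vertex has a successor, and an undecorated one has
      at most one. So both definite descriptions denote, and the matching condition relates their
      values.\<close>
    have "succs G u \<noteq> {}"
      using G(2) u(1) rank unfolding BESsy_def by blast
    then obtain v where v: "v \<in> succs G u"
      by blast
    then obtain v' where v': "v' \<in> succs G' u'" "(v, v') \<in> R"
      using bisim_succ[OF R uu'] by blast
    have "w = v" if "w \<in> succs G u" for w
      using G(2) u(1) other v that unfolding BESsy_def by blast
    then have the: "(THE w. w \<in> succs G u) = v"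
      using v by blast
    have "w = v'" if "w \<in> succs G' u'" for w
      using G'(2) u(2) other v' that unfolding BESsy_def labels(1)[symmetric] by blast
    then have the': "(THE w. w \<in> succs G' u') = v'"
      using v' by blast
    show ?thesis
      using phi_le[OF le v'(2)] other unfolding rhs_def labels the the' by simp
  qed
qed

end

section \<open>Equation systems of bisimilar graphs\<close>

text \<open>Since ranks descend along \<open>us\<close>, this is a suffix of the whole system; the
  bound is strict, so \<open>k = 0\<close> gives the empty system.\<close>

definition BES_below ::
  "'x form rel \<Rightarrow> ('v \<Rightarrow> 'x) \<Rightarrow> ('v, 'x) sgraph \<Rightarrow> 'v list \<Rightarrow> nat \<Rightarrow> 'x bes" where
  "BES_below r X G us k = map (equation r X G) (filter (\<lambda>u. the (rank G u) < k) us)"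

definition BES_at ::
  "'x form rel \<Rightarrow> ('v \<Rightarrow> 'x) \<Rightarrow> ('v, 'x) sgraph \<Rightarrow> 'v list \<Rightarrow> nat \<Rightarrow> 'x bes" where
  "BES_at r X G us k = map (equation r X G) (filter (\<lambda>u. the (rank G u) = k) us)"

lemma filter_less_Suc_sorted:
  assumes "sorted_wrt (\<lambda>u v. f u \<ge> f v) us"
  shows "filter (\<lambda>u. f u < Suc k) us = filter (\<lambda>u. f u = k) us @ filter (\<lambda>u. f u < k) us"
  using assms
proof (induction us)
  case Nil
  then show ?case by simp
next
  case (Cons u us)
  then have "filter (\<lambda>v. f v = k) us = []" if "f u < k"
    using that by (auto simp: filter_empty_conv)
  then show ?case
    using Cons by auto
qed

lemma BES_below_Suc:
  assumes "sorted_wrt (\<lambda>u v. the (rank G u) \<ge> the (rank G v)) us"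
  shows "BES_below r X G us (Suc k) = BES_at r X G us k @ BES_below r X G us k"
  using filter_less_Suc_sorted[OF assms, of k] by (simp add: BES_below_def BES_at_def)

lemma bound_vars_BES_below:
  "bound_vars (BES_below r X G us k) = X ` {u \<in> set us. the (rank G u) < k}"
  by (force simp: bound_vars_def BES_below_def equation_def)

lemma bound_vars_BES_at:
  "bound_vars (BES_at r X G us k) = X ` {u \<in> set us. the (rank G u) = k}"
  by (force simp: bound_vars_def BES_at_def equation_def)

lemma distinct_BES_at:
  assumes "inj_on X (set us)" "distinct us"
  shows "distinct (map (\<lambda>(\<sigma>, x, f). x) (BES_at r X G us k))"
proof -
  have "map (\<lambda>(\<sigma>, x, f). x) (BES_at r X G us k) = map X (filter (\<lambda>u. the (rank G u) = k) us)"
    by (simp add: BES_at_def equation_def)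
  then show ?thesis
    using assms by (auto simp: distinct_map intro: inj_on_subset)
qed

text \<open>Induction on \<open>k\<close>, peeling off the block of rank \<open>k\<close> as the
  outermost one. The environments are generalised because a block passes changed ones inwards; only
  unbound variables are compared initially, as bound ones are overwritten.\<close>

lemma sol_BES_below_le:
  assumes r: "linear_order r"
    and G: "structure_graph G" "BESsy G"
    and G': "structure_graph G'" "BESsy G'"
    and R: "bisimulation G G' R"
    and labelled: "\<And>u. u \<in> Domain R \<Longrightarrow> dec G u \<noteq> None \<or> rank G u \<noteq> None \<or> fvar G u \<noteq> None"
    and X: "fresh_vars G X" and X': "fresh_vars G' X'"
    and us: "distinct us" "set us = {u \<in> verts G. rank G u \<noteq> None}"
      "sorted_wrt (\<lambda>u v. the (rank G u) \<ge> the (rank G v)) us"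
    and us': "distinct us'" "set us' = {u \<in> verts G'. rank G' u \<noteq> None}"
      "sorted_wrt (\<lambda>u v. the (rank G' u) \<ge> the (rank G' v)) us'"
    and le: "\<forall>(x, x')\<in>var_rel G X X' R. x \<notin> bound_vars (BES_below r X G us k) \<longrightarrow>
        sgn_le \<tau> (\<eta> x) (\<eta>' x')"
  shows "\<forall>(x, x')\<in>var_rel G X X' R.
    sgn_le \<tau> (sol (BES_below r X G us k) \<eta> x) (sol (BES_below r X' G' us' k) \<eta>' x')"
  using le
proof (induction k arbitrary: \<eta> \<eta>' \<tau>)
  case 0
  then show ?case
    by (simp add: BES_below_def)
next
  case (Suc k)
  note verts = bisim_verts[OF R] and labels = bisim_labels[OF R]
  let ?Q = "var_rel G X X' R"
  let ?B = "BES_at r X G us k" and ?B' = "BES_at r X' G' us' k"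
  let ?E = "BES_below r X G us k" and ?E' = "BES_below r X' G' us' k"
  have inj: "inj_on X (verts G)" "inj_on X' (verts G')"
    and fresh: "\<And>u v. u \<in> verts G \<Longrightarrow> v \<in> verts G \<Longrightarrow> fvar G v \<noteq> Some (X u)"
      "\<And>u v. u \<in> verts G' \<Longrightarrow> v \<in> verts G' \<Longrightarrow> fvar G' v \<noteq> Some (X' u)"
    using X X' by (auto simp: fresh_vars_def)
  have X_in: "X u \<in> X ` {u \<in> set us. P (the (rank G u))} \<longleftrightarrow> rank G u \<noteq> None \<and> P (the (rank G u))"
    if "u \<in> verts G" for u P
    using that inj(1) us(2) by (auto dest: inj_onD)
  have X'_in: "X' u \<in> X' ` {u \<in> set us'. P (the (rank G' u))} \<longleftrightarrow>
      rank G' u \<noteq> None \<and> P (the (rank G' u))" if "u \<in> verts G'" for u P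
    using that inj(2) us'(2) by (auto dest: inj_onD)
  \<comment> \<open>Related ranked vertices have equal rank, and a free-variable label is bound in
    neither system by freshness. \<open>P\<close> is later instantiated to rank equal to
    \<open>k\<close> and rank below \<open>k\<close>.\<close>
  have bound_iff: "x \<in> X ` {u \<in> set us. P (the (rank G u))} \<longleftrightarrow>
      x' \<in> X' ` {u \<in> set us'. P (the (rank G' u))}" if "(x, x') \<in> ?Q" for x x' P
    using that unfolding var_rel_def
  proof (elim UnE)
    assume "(x, x') \<in> {(X u, X' u') | u u'. (u, u') \<in> R \<and> rank G u \<noteq> None}"
    then obtain u u' where x: "x = X u" "x' = X' u'" "(u, u') \<in> R"
      by blast
    then show ?thesis
      unfolding x(1,2) using verts[OF x(3)] labels[OF x(3)] by (simp only: X_in X'_in)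
  next
    assume "(x, x') \<in> {(Y, Y) | Y. \<exists>(u, u')\<in>R. fvar G u = Some Y}"
    then obtain u u' where "x' = x" "(u, u') \<in> R" "fvar G u = Some x"
      by blast
    then show ?thesis
      using verts[of u u'] labels[of u u'] fresh us(2) us'(2) by fastforce
  qed
  define \<sigma> where "\<sigma> = (if odd k then Mu else Nu)"
  have signs: "fst e = \<sigma>" if "e \<in> set ?B \<or> e \<in> set ?B'" for e
    using that by (auto simp: BES_at_def equation_def \<sigma>_def)
  have inj_us: "inj_on X (set us)" "inj_on X' (set us')"
    using inj us(2) us'(2) by (auto intro: inj_on_subset)
  have dist: "distinct (map (\<lambda>(\<sigma>, x, f). x) ?B)" "distinct (map (\<lambda>(\<sigma>, x, f). x) ?B')"
    using distinct_BES_at inj_us us(1) us'(1) by blast+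
  have rhs: "sgn_le \<tau> (eval f \<rho>) (eval f' \<rho>')"
    if f: "(\<sigma>, x, f) \<in> set ?B" "(\<sigma>, x', f') \<in> set ?B'" "(x, x') \<in> ?Q"
      and le: "\<forall>(x, x')\<in>?Q. sgn_le \<tau> (\<rho> x) (\<rho>' x')" for x x' f f' \<rho> \<rho>' \<tau>
  proof -
    obtain u where u: "u \<in> set us" "x = X u" "f = Defs.rhs r X G u"
      using f(1) by (auto simp: BES_at_def equation_def)
    obtain u' where u': "u' \<in> set us'" "x' = X' u'" "f' = Defs.rhs r X' G' u'"
      using f(2) by (auto simp: BES_at_def equation_def)
    \<comment> \<open>Injectivity of \<open>X\<close> and \<open>X'\<close> recovers the vertices
      from their variables; freshness excludes the free-variable pairs.\<close>
    from f(3) have "(u, u') \<in> R"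
      unfolding var_rel_def
    proof (elim UnE)
      assume "(x, x') \<in> {(X u, X' u') | u u'. (u, u') \<in> R \<and> rank G u \<noteq> None}"
      then obtain v v' where v: "x = X v" "x' = X' v'" "(v, v') \<in> R"
        by blast
      then have "v = u" "v' = u'"
        using verts[OF v(3)] u u' us(2) us'(2) inj by (auto dest: inj_onD)
      with v show ?thesis
        by simp
    next
      assume "(x, x') \<in> {(Y, Y) | Y. \<exists>(u, u')\<in>R. fvar G u = Some Y}"
      then show ?thesis
        using verts u us(2) fresh(1) by blast
    qed
    then show ?thesis
      unfolding u(3) u'(3) using u(1) us(2)
      by (intro rhs_le[OF r G G' R labelled le]) auto
  qed
  have bound_at: "x \<in> bound_vars ?B \<longleftrightarrow> x' \<in> bound_vars ?B'" if "(x, x') \<in> ?Q" for x x'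
    unfolding bound_vars_BES_at by (rule bound_iff[OF that])
  have bound_below: "x \<in> bound_vars ?E \<longleftrightarrow> x' \<in> bound_vars ?E'" if "(x, x') \<in> ?Q" for x x'
    unfolding bound_vars_BES_below by (rule bound_iff[OF that])
  have prems: "\<forall>(x, x')\<in>?Q. x \<notin> bound_vars (?B @ ?E) \<longrightarrow> sgn_le \<tau> (\<eta> x) (\<eta>' x')"
    using Suc.prems unfolding BES_below_Suc[OF us(3)] .
  show ?case
    unfolding BES_below_Suc[OF us(3)] BES_below_Suc[OF us'(3)]
  proof (cases "\<tau> = \<sigma>")
    case True
    show "\<forall>(x, x')\<in>?Q. sgn_le \<tau> (sol (?B @ ?E) \<eta> x) (sol (?B' @ ?E') \<eta>' x')"
      unfolding True
    proof (rule sol_block_le[OF _ _ dist bound_at rhs])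
      show "\<forall>(x, x')\<in>?Q. x \<notin> bound_vars (?B @ ?E) \<longrightarrow> sgn_le \<sigma> (\<eta> x) (\<eta>' x')"
        using prems unfolding True .
    qed (use signs Suc.IH in auto)
  next
    case False
    then have flip: "sgn_le \<tau> a b \<longleftrightarrow> sgn_le \<sigma> b a" for a b
      using sgn_le_flip by blast
    \<comment> \<open>Leastness is now available on the side of \<open>G'\<close>, so the block
      comparison runs from \<open>G'\<close> to \<open>G\<close> along the converse
      relation.\<close>
    have "\<forall>(x', x)\<in>?Q\<inverse>. sgn_le \<sigma> (sol (?B' @ ?E') \<eta>' x') (sol (?B @ ?E) \<eta> x)"
    proof (rule sol_block_le[OF _ _ dist(2,1)])
      show "\<forall>(x', x)\<in>?Q\<inverse>. x' \<notin> bound_vars (?B' @ ?E') \<longrightarrow> sgn_le \<sigma> (\<eta>' x') (\<eta> x)"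
        using prems bound_at bound_below unfolding flip by auto
      show "x' \<in> bound_vars ?B' \<longleftrightarrow> x \<in> bound_vars ?B" if "(x', x) \<in> ?Q\<inverse>" for x' x
        using that bound_at by blast
      show "sgn_le \<sigma> (eval f' \<rho>') (eval f \<rho>)"
        if "(\<sigma>, x', f') \<in> set ?B'" "(\<sigma>, x, f) \<in> set ?B" "(x', x) \<in> ?Q\<inverse>"
          "\<forall>(x', x)\<in>?Q\<inverse>. sgn_le \<sigma> (\<rho>' x') (\<rho> x)" for x x' f f' \<rho> \<rho>'
        using rhs[of x f x' f' \<tau> \<rho> \<rho>'] that unfolding flip by blast
      show "\<forall>(x', x)\<in>?Q\<inverse>. sgn_le \<sigma> (sol ?E' \<rho>' x') (sol ?E \<rho> x)"
        if "\<forall>(x', x)\<in>?Q\<inverse>. x' \<notin> bound_vars ?E' \<longrightarrow> sgn_le \<sigma> (\<rho>' x') (\<rho> x)" for \<rho> \<rho>'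
      proof -
        have "\<forall>(x, x')\<in>?Q. x \<notin> bound_vars ?E \<longrightarrow> sgn_le \<tau> (\<rho> x) (\<rho>' x')"
          using that bound_below unfolding flip by blast
        from Suc.IH[OF this] show ?thesis
          unfolding flip by blast
      qed
    qed (use signs in auto)
    then show "\<forall>(x, x')\<in>?Q. sgn_le \<tau> (sol (?B @ ?E) \<eta> x) (sol (?B' @ ?E') \<eta>' x')"
      unfolding flip by blast
  qed
qed

text \<open>\<open>labelled\<close> excludes reachable vertices without any label: their formulae
  would be unbound variables, on whose values in the two graphs \<open>\<eta>\<close> need not
  agree.\<close>

theorem theorem5p9:
  fixes G :: "('v, 'x) sgraph" and G' :: "('w, 'x) sgraph"
    and r :: "'x form rel"
    and X :: "'v \<Rightarrow> 'x" and X' :: "'w \<Rightarrow> 'x"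
    and E E' :: "'x bes"
    and \<eta> :: "'x env"
  assumes "linear_order r"
    and "structure_graph G" and "BESsy G"
    and "structure_graph G'" and "BESsy G'"
    and labelled: "\<forall>u. (root G, u) \<in> (edges G)\<^sup>* \<longrightarrow>
           dec G u \<noteq> None \<or> rank G u \<noteq> None \<or> fvar G u \<noteq> None"
    and "bisimilar G G'"
    and "fresh_vars G X" and "is_BES r X G E"
    and "fresh_vars G' X'" and "is_BES r X' G' E'"
  shows "eval (phi r X G (root G)) (sol E \<eta>) = eval (phi r X' G' (root G')) (sol E' \<eta>)"
proof -
  obtain R0 where R0: "bisimulation G G' R0" "(root G, root G') \<in> R0"
    using assms(7) by (auto simp: bisimilar_def)
  \<comment> \<open>Restricting to vertices reachable from the root lets \<open>labelled\<close>
    cover the domain; closure of reachability under successors keeps the matching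
    conditions.\<close>
  define R where "R = {(u, u') \<in> R0. (root G, u) \<in> (edges G)\<^sup>*}"
  have R: "bisimulation G G' R"
    unfolding bisimulation_def
  proof (intro conjI ballI, goal_cases)
    case 1
    then show ?case
      using R0(1) by (auto simp: R_def bisimulation_def)
  next
    case (2 p)
    obtain u u' where p: "p = (u, u')" "(u, u') \<in> R0" "(root G, u) \<in> (edges G)\<^sup>*"
      using 2 by (auto simp: R_def)
    have reach: "(root G, v) \<in> (edges G)\<^sup>*" if "v \<in> succs G u" for v
      using p(3) that by (auto intro: rtrancl_into_rtrancl)
    have "\<exists>v'\<in>succs G' u'. (v, v') \<in> R" if "v \<in> succs G u" for v
      using bisim_succ[OF R0(1) p(2) that] reach[OF that] by (auto simp: R_def)
    moreover have "\<exists>v\<in>succs G u. (v, v') \<in> R" if "v' \<in> succs G' u'" for v'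
      using bisim_succ'[OF R0(1) p(2) that] reach by (auto simp: R_def)
    ultimately show ?case
      using bisim_labels[OF R0(1) p(2)] unfolding p(1) by simp
  qed
  have root: "(root G, root G') \<in> R"
    using R0(2) by (simp add: R_def)
  have lab: "dec G u \<noteq> None \<or> rank G u \<noteq> None \<or> fvar G u \<noteq> None" if "u \<in> Domain R" for u
    using that labelled by (auto simp: R_def)
  obtain us where us: "distinct us" "set us = {u \<in> verts G. rank G u \<noteq> None}"
    "sorted_wrt (\<lambda>u v. the (rank G u) \<ge> the (rank G v)) us" "E = map (equation r X G) us"
    using assms(9) by (auto simp: is_BES_def)
  obtain us' where us': "distinct us'" "set us' = {u \<in> verts G'. rank G' u \<noteq> None}"
    "sorted_wrt (\<lambda>u v. the (rank G' u) \<ge> the (rank G' v)) us'" "E' = map (equation r X' G') us'"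
    using assms(11) by (auto simp: is_BES_def)
  \<comment> \<open>\<open>K\<close> exceeds every rank in both graphs, so the slices below it are
    the full systems.\<close>
  define K where "K = Suc (Max ((the \<circ> rank G) ` set us \<union> (the \<circ> rank G') ` set us'))"
  have "the (rank G u) < K" if "u \<in> set us" for u
    using that unfolding K_def by (intro le_imp_less_Suc Max_ge) auto
  then have E: "BES_below r X G us K = E"
    unfolding us(4) BES_below_def by (subst filter_True) auto
  have "the (rank G' u) < K" if "u \<in> set us'" for u
    using that unfolding K_def by (intro le_imp_less_Suc Max_ge) auto
  then have E': "BES_below r X' G' us' K = E'"
    unfolding us'(4) BES_below_def by (subst filter_True) auto
  have bound: "X u \<in> bound_vars E" if "(u, u') \<in> R" "rank G u \<noteq> None" for u u'
    using that bisim_verts[OF R that(1)] us(2) unfolding us(4) bound_vars_def equation_def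
    by force
  \<comment> \<open>Fresh variables of related ranked vertices are bound in \<open>E\<close>; the
    remaining pairs are diagonal, where the common \<open>\<eta>\<close> gives reflexivity.\<close>
  have "\<forall>(x, x')\<in>var_rel G X X' R. x \<notin> bound_vars (BES_below r X G us K) \<longrightarrow> sgn_le \<tau> (\<eta> x) (\<eta> x')"
    for \<tau>
    unfolding E using bound by (auto simp: var_rel_def sgn_le_def)
  from sol_BES_below_le[OF assms(1-5) R lab assms(8,10) us(1-3) us'(1-3) this]
  have "sgn_le \<tau> (eval (phi r X G (root G)) (sol E \<eta>)) (eval (phi r X' G' (root G')) (sol E' \<eta>))"
    for \<tau>
    unfolding E E' using phi_le[OF assms(1-5) R lab _ root] by blast
  from this[of Mu] this[of Nu] show ?thesis
    by (auto simp: sgn_le_def)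
qed

end
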